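(* Let $d\in\mathbb{N}$, $d>0$, and let $X_1,X_2,\dots$ be a sequence of i.i.d. data drawn from a distribution having a density $f$ with respect to $d$-dimensional Lebesgue measure on $\mathbb{R}^d$, with non-compact support $M'\subset\mathbb{R}^d$, where $f$ is zero on $\mathbb{R}^d\setminus M'$ and continuous on $M'$. Let $S_0=\{\boldsymbol{x}\in M':f(\boldsymbol{x})=0\}$ be its zero-density region, of Minkowski dimension $d_0<d$, and suppose $S_0$ is contained in the interior of $M'$ and has one connected component. Let $0<\delta<1$ be fixed and let $S_f^{1-\delta}$ be a $(1-\delta)$-support containing $S_0$, with $S_f^{1-\delta}\subset\operatorname{int}M'$. Assume: (i) there exists $\epsilon_0>0$ such that $\overline{K_f}(\epsilon_0)>0$ and $\underline{K_f}(\epsilon_0)>0$ exist; (ii) there exist positive constants $L_f,U_f$ such that for all $\epsilon$ with $0<\epsilon<\min(1,\epsilon_0)$ and all $\boldsymbol{x}\in B_\epsilon(S_0)\cap S_f^{1-\delta}$, $$L_f\, d(\boldsymbol{x},S_0)^{\overline{K_f}(\epsilon)}\le f(\boldsymbol{x})\le U_f\, d(\boldsymbol{x},S_0)^{\underline{K_f}(\epsilon)};$$ (iii) $\mathcal{B}^d_{r(n)}(S_f^{1-\delta})$ is a sequence of coverings of $S_f^{1-\delta}$ by balls of radius $r(n)$ with centers in $\operatorname{int}S_f^{1-\delta}$, where $r(n)\sim O(n^{-\eta})$, $0<\eta<\frac1d$, and $|\mathcal{B}^d_{r(n)}(S_f^{1-\delta})|\sim O(n^{d\eta})$; (iv) for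 each $\tau>0$, the number of balls in $\mathcal{B}^d_{r(n)}(S_f^{1-\delta})$ intersecting $S_0$ is bounded from above by some $H_\tau(n)\sim O(n^{d_0\eta(1+\tau)})$; (v) $\epsilon(n)\sim O(n^{-\psi})$ with $0<\psi\le\eta$, and $2r(n)\le\epsilon(n)<1$; (vi) $m(f,n):=\min_{\boldsymbol{w}\in S_f^{1-\delta}\setminus B_{\epsilon(n)}(S_0)}f(\boldsymbol{w})\in(0,\infty)$ and $m(f,n)\sim O(n^{-\xi})$ for some $0<\xi<\frac{1-2\eta d}{2}$. Then: (A) If $1-2\eta d-2\overline{K_f}\,\psi>0$, then $\lim_{n\to\infty}P(\text{there are no empty }\epsilon(n)\text{-outside balls})=1$. (B) If $1+d_0\eta-\underline{K_f}\,\eta-d\eta<0$, then $\lim_{n\to\infty}P(\text{all }\epsilon(n)\text{-inside balls are empty})=1$.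
   Context: Balls are open Euclidean balls $B_r(\boldsymbol{x})=\{\boldsymbol{y}\in\mathbb{R}^d:\|\boldsymbol{x}-\boldsymbol{y}\|<r\}$; $d(\boldsymbol{x},S_0)=\inf_{\boldsymbol{y}\in S_0}\|\boldsymbol{x}-\boldsymbol{y}\|$; $B_\epsilon(S_0)=\{\boldsymbol{x}\in\mathbb{R}^d: d(\boldsymbol{x},S_0)<\epsilon\}$. A covering of a set is a collection of balls whose union contains the set; $|\cdot|$ denotes its cardinality. Support: the support of a random vector $X$ with density $f$ is the intersection of all closed sets $R\subset\mathbb{R}^d$ with $P(X\in R)=1$. $(1-\delta)$-support containing $S_0$: a set $S_f^{1-\delta}=[-B,B]^d$ for some $B\in(0,\infty)$ such that $S_0\subset\operatorname{int}S_f^{1-\delta}=(-B,B)^d$ and $P\{X\in S_f^{1-\delta}\}=1-\delta$, where $X$ has density $f$. Upper and lower $\epsilon$-order of smoothness: $$\overline{K_f}(\epsilon)=\inf\Big\{\alpha>0: 0<\inf_{\boldsymbol{x}\in B_\epsilon(S_0)\setminus S_0}\frac{f(\boldsymbol{x})}{d(\boldsymbol{x},S_0)^\alpha}\Big\},\qquad \underline{K_f}(\epsilon)=\sup\Big\{\alpha>0: \infty>\sup_{\boldsymbol{x}\in B_\epsilon(S_0)\setminus S_0}\frac{f(\boldsymbol{x})}{d(\boldsymbol{x},S_0)^\alpha}\Big\},$$ and $\overline{K_f}=\lim_{\epsilon\to0^+}\overline{K_f}(\epsilon)$, $\underline{K_f}=\lim_{\epsilon\to0^+}\underline{K_f}(\epsilon)$;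 these limits exist when the quantities exist for some $\epsilon_0$. Types of balls of the covering: $B_{r}(\boldsymbol{x})$ is an $\epsilon$-outside ball if $\boldsymbol{x}\notin B_\epsilon(S_0)$; an $\epsilon$-inside ball if $\boldsymbol{x}\in B_\epsilon(S_0)$ and $B_r(\boldsymbol{x})\cap S_0\neq\emptyset$. In the conclusions these refer to balls in the covering $\mathcal{B}^d_{r(n)}(S_f^{1-\delta})$ with $r=r(n)$, $\epsilon=\epsilon(n)$. A ball is empty if it contains none of $X_1,\dots,X_n$. Big O convention (two-sided): for positive real sequences $a(n),b(n)$, $a\sim O(b)$ means there are constants $L_1,L_2\in(0,\infty)$ and $n_0\in\mathbb{N}$ with $L_1 b(n)\le a(n)\le L_2 b(n)$ for all $n>n_0$. Minkowski (box-counting) dimension: for bounded $E\subset\mathbb{R}^d$ let $\mathcal{N}_\Delta(E)$ be the smallest number of balls of radius $\Delta>0$ needed to cover $E$; the Minkowski dimension of $E$ is $\lim_{\Delta\to0}\log\mathcal{N}_\Delta(E)/(-\log\Delta)$ when this limit exists. *)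

theory Defs
  imports "HOL-Probability.Probability"
begin

definition rv_support :: "'w measure \<Rightarrow> ('w \<Rightarrow> 'a::topological_space) \<Rightarrow> 'a set" where
  "rv_support M X = \<Inter>{R. closed R \<and> \<P>(\<omega> in M. X \<omega> \<in> R) = 1}"

definition nbhd :: "real \<Rightarrow> 'a::metric_space set \<Rightarrow> 'a set" where
  "nbhd \<epsilon> S\<^sub>0 = {x. infdist x S\<^sub>0 < \<epsilon>}"

definition ball_covering :: "real \<Rightarrow> 'a::metric_space set \<Rightarrow> 'a set set \<Rightarrow> bool" where
  "ball_covering r S \<B> \<longleftrightarrow> (\<forall>b\<in>\<B>. \<exists>x. b = ball x r) \<and> S \<subseteq> \<Union>\<B>"

definition covering_number :: "real \<Rightarrow> 'a::metric_space set \<Rightarrow> nat" where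
  "covering_number \<Delta> E = (LEAST k. \<exists>\<B>. finite \<B> \<and> card \<B> = k \<and> ball_covering \<Delta> E \<B>)"

definition has_minkowski_dim :: "'a::metric_space set \<Rightarrow> real \<Rightarrow> bool" where
  "has_minkowski_dim E D \<longleftrightarrow> bounded E \<and>
     ((\<lambda>\<Delta>. ln (real (covering_number \<Delta> E)) / (- ln \<Delta>)) \<longlongrightarrow> D) (at_right 0)"

definition delta_support ::
    "'w measure \<Rightarrow> ('w \<Rightarrow> real^'d) \<Rightarrow> real \<Rightarrow> (real^'d) set \<Rightarrow> (real^'d) set \<Rightarrow> bool" where
  "delta_support M X \<delta> S\<^sub>0 S \<longleftrightarrow>
     (\<exists>B>0. S = cbox (\<chi> i. - B) (\<chi> i. B)) \<and> S\<^sub>0 \<subseteq> interior S \<and>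
     \<P>(\<omega> in M. X \<omega> \<in> S) = 1 - \<delta>"

text \<open>
  The orders of smoothness are extended reals: an infimum or supremum that does not exist as a
  real number takes an infinite value (\<open>\<infinity>\<close> for the infimum and \<open>-\<infinity>\<close> for the supremum
  of the empty set).
\<close>

definition upper_order_at :: "('a::metric_space \<Rightarrow> real) \<Rightarrow> 'a set \<Rightarrow> real \<Rightarrow> ereal" where
  "upper_order_at f S\<^sub>0 \<epsilon> = Inf (ereal ` {\<alpha>. 0 < \<alpha> \<and>
     0 < (INF x \<in> nbhd \<epsilon> S\<^sub>0 - S\<^sub>0. ereal (f x / infdist x S\<^sub>0 powr \<alpha>))})"

definition lower_order_at :: "('a::metric_space \<Rightarrow> real) \<Rightarrow> 'a set \<Rightarrow> real \<Rightarrow> ereal" where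
  "lower_order_at f S\<^sub>0 \<epsilon> = Sup (ereal ` {\<alpha>. 0 < \<alpha> \<and>
     (SUP x \<in> nbhd \<epsilon> S\<^sub>0 - S\<^sub>0. ereal (f x / infdist x S\<^sub>0 powr \<alpha>)) < \<infinity>})"

definition upper_order :: "('a::metric_space \<Rightarrow> real) \<Rightarrow> 'a set \<Rightarrow> ereal" where
  "upper_order f S\<^sub>0 = Lim (at_right 0) (upper_order_at f S\<^sub>0)"

definition lower_order :: "('a::metric_space \<Rightarrow> real) \<Rightarrow> 'a set \<Rightarrow> ereal" where
  "lower_order f S\<^sub>0 = Lim (at_right 0) (lower_order_at f S\<^sub>0)"

text \<open>
  Two-sided big-O for positive sequences indexed by \<open>n \<ge> 1\<close>; the value at \<open>0\<close> is irrelevant.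
\<close>

definition two_sided_O :: "(nat \<Rightarrow> real) \<Rightarrow> (nat \<Rightarrow> real) \<Rightarrow> bool" where
  "two_sided_O a b \<longleftrightarrow> (\<forall>n\<ge>1. 0 < a n \<and> 0 < b n) \<and>
     (\<exists>L\<^sub>1>0. \<exists>L\<^sub>2>0. \<exists>n\<^sub>0. \<forall>n>n\<^sub>0. L\<^sub>1 * b n \<le> a n \<and> a n \<le> L\<^sub>2 * b n)"

text \<open>
  The center of a ball of positive radius in a Euclidean space is determined by the ball and the
  radius, so the existential quantifiers below pick out the center.
\<close>

definition outside_ball :: "real \<Rightarrow> real \<Rightarrow> 'a::metric_space set \<Rightarrow> 'a set \<Rightarrow> bool" where
  "outside_ball r \<epsilon> S\<^sub>0 b \<longleftrightarrow> (\<exists>x. b = ball x r \<and> x \<notin> nbhd \<epsilon> S\<^sub>0)"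

definition inside_ball :: "real \<Rightarrow> real \<Rightarrow> 'a::metric_space set \<Rightarrow> 'a set \<Rightarrow> bool" where
  "inside_ball r \<epsilon> S\<^sub>0 b \<longleftrightarrow> (\<exists>x. b = ball x r \<and> x \<in> nbhd \<epsilon> S\<^sub>0) \<and> b \<inter> S\<^sub>0 \<noteq> {}"

definition empty_ball :: "(nat \<Rightarrow> 'w \<Rightarrow> 'a) \<Rightarrow> nat \<Rightarrow> 'w \<Rightarrow> 'a set \<Rightarrow> bool" where
  "empty_ball X n \<omega> b \<longleftrightarrow> (\<forall>i\<in>{1..n}. X i \<omega> \<notin> b)"

end

theory Submission
  imports Defs "HOL-Real_Asymp.Real_Asymp"
begin

text \<open>
  Both claims are union bounds, fed by bounds on the mass \<open>P(X\<^sub>i \<in> b)\<close> of a single ball \<open>b\<close>.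
  Write \<open>d\<close> for \<open>CARD('d)\<close> and \<open>K\<close> for the real order of smoothness in the claim at hand.

  For outside balls, every point of \<open>b\<close> keeps distance at least \<open>\<epsilon>(n)/2\<close> from \<open>S\<^sub>0\<close>,
  because \<open>2r(n) \<le> \<epsilon>(n)\<close>. On \<open>b \<inter> S\<^sub>f\<close> the density is therefore eventually at least the smaller of
  \<open>m(n)\<close> (outside the \<open>\<epsilon>(n)\<close>-neighbourhood) and \<open>L\<^sub>f (\<epsilon>(n)/2)\<^sup>\<kappa>\<close> (inside it), where
  \<open>\<kappa>\<close> is any exponent above the upper order \<open>K\<close>. Although \<open>b\<close> may stick out of the cube
  \<open>S\<^sub>f\<close>, its center lies in the cube, so \<open>b \<inter> S\<^sub>f\<close> contains a cube of side comparable to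
  \<open>r(n)\<close> (lemma \<open>cube_in_ball_inter_cube\<close>). So \<open>b\<close> has mass at least a constant times
  \<open>n powr -(d\<eta> + max \<xi> (\<psi>\<kappa>))\<close>. By independence \<open>b\<close> is empty with probability at most
  \<open>exp (-c n\<^sup>t)\<close>, where \<open>t = 1 - d\<eta> - max \<xi> (\<psi>\<kappa>)\<close> is positive for \<open>\<kappa>\<close> close to \<open>K\<close>. This
  beats the polynomial number of balls (lemma \<open>prob_no_empty_outside_ball_tendsto\<close>).

  For inside balls, every point of \<open>b\<close> has distance less than \<open>2r(n)\<close> from \<open>S\<^sub>0\<close>. As \<open>S\<^sub>0\<close> is
  compact and interior to \<open>S\<^sub>f\<close>, such balls eventually lie in \<open>S\<^sub>f\<close>, where the density is at most
  \<open>U\<^sub>f (2r(n))\<^sup>\<kappa>\<close> for any positive \<open>\<kappa>\<close> below the lower order \<open>K\<close>. The mass of \<open>b\<close> is thus at most a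
  constant times \<open>n powr -(\<kappa>\<eta> + d\<eta>)\<close>. With at most \<open>n powr (d\<^sub>0\<eta>(1 + \<tau>))\<close> such balls, up to a
  constant, and \<open>n\<close> sample points, some inside ball is hit with probability at most of order
  \<open>n powr (1 + d\<^sub>0\<eta>(1 + \<tau>) - \<kappa>\<eta> - d\<eta>)\<close>. This tends to zero for \<open>\<tau>\<close> small and \<open>\<kappa>\<close> close to \<open>K\<close>
  (lemma \<open>prob_all_inside_balls_empty_tendsto\<close>).
\<close>

section \<open>Probability that balls are hit by a sample\<close>

lemma (in prob_space) prob_density_ge:
  assumes Y: "distributed M lborel Y (\<lambda>x. ennreal (f x))" and A: "A \<in> sets borel"
    and le: "\<And>x. x \<in> A \<Longrightarrow> c \<le> f x" and c: "0 \<le> c" and fin: "emeasure lborel A < \<infinity>"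
  shows "c * measure lborel A \<le> \<P>(\<omega> in M. Y \<omega> \<in> A)"
proof -
  have "ennreal (c * measure lborel A) = ennreal c * emeasure lborel A"
    using c fin by (simp add: ennreal_mult emeasure_eq_ennreal_measure less_top)
  also have "\<dots> = (\<integral>\<^sup>+x. ennreal c * indicator A x \<partial>lborel)"
    using A by (subst nn_integral_cmult_indicator) auto
  also have "\<dots> \<le> (\<integral>\<^sup>+x. ennreal (f x) * indicator A x \<partial>lborel)"
    using le by (intro nn_integral_mono) (auto simp: indicator_def intro!: ennreal_leI)
  also have "\<dots> = emeasure M (Y -` A \<inter> space M)"
    using distributed_emeasure[OF Y, of A] A by simp
  also have "\<dots> = ennreal (\<P>(\<omega> in M. Y \<omega> \<in> A))"
    by (simp add: emeasure_eq_measure vimage_def Int_def conj_commute)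
  finally show ?thesis by simp
qed

lemma (in prob_space) prob_density_le:
  assumes Y: "distributed M lborel Y (\<lambda>x. ennreal (f x))" and A: "A \<in> sets borel"
    and le: "\<And>x. x \<in> A \<Longrightarrow> f x \<le> c" and c: "0 \<le> c" and fin: "emeasure lborel A < \<infinity>"
  shows "\<P>(\<omega> in M. Y \<omega> \<in> A) \<le> c * measure lborel A"
proof -
  have "ennreal (\<P>(\<omega> in M. Y \<omega> \<in> A)) = emeasure M (Y -` A \<inter> space M)"
    by (simp add: emeasure_eq_measure vimage_def Int_def conj_commute)
  also have "\<dots> = (\<integral>\<^sup>+x. ennreal (f x) * indicator A x \<partial>lborel)"
    using distributed_emeasure[OF Y, of A] A by simp
  also have "\<dots> \<le> (\<integral>\<^sup>+x. ennreal c * indicator A x \<partial>lborel)"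
    using le by (intro nn_integral_mono) (auto simp: indicator_def intro!: ennreal_leI)
  also have "\<dots> = ennreal c * emeasure lborel A"
    using A by (subst nn_integral_cmult_indicator) auto
  also have "\<dots> = ennreal (c * measure lborel A)"
    using c fin by (simp add: ennreal_mult emeasure_eq_ennreal_measure less_top)
  finally show ?thesis using c by simp
qed

text \<open>Independence turns the probability of missing \<open>A\<close> with all \<open>n\<close> points into a product of
  factors, each at most \<open>1 - p \<le> exp (- p)\<close>.\<close>
lemma (in prob_space) prob_empty_ball_le_exp:
  assumes ind: "indep_vars (\<lambda>_. borel) X {1..}" and A: "A \<in> sets borel" and n: "1 \<le> n"
    and p: "\<And>i. 1 \<le> i \<Longrightarrow> p \<le> \<P>(\<omega> in M. X i \<omega> \<in> A)"
  shows "\<P>(\<omega> in M. empty_ball X n \<omega> A) \<le> exp (- (real n * p))"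
proof -
  have X[measurable]: "X i \<in> borel_measurable M" if "1 \<le> i" for i
    using ind that unfolding indep_vars_def by auto
  note A[measurable]
  have "\<P>(\<omega> in M. empty_ball X n \<omega> A) = prob (\<Inter>i\<in>{1..n}. X i -` (- A) \<inter> space M)"
    unfolding empty_ball_def using n by (intro arg_cong[where f = prob]) force
  also have "\<dots> = (\<Prod>i\<in>{1..n}. prob (X i -` (- A) \<inter> space M))"
    using n A by (intro indep_varsD[OF ind]) auto
  also have "\<dots> \<le> (\<Prod>i\<in>{1..n}. exp (- p))"
  proof (intro prod_mono conjI measure_nonneg)
    fix i assume i: "i \<in> {1..n}"
    have [measurable]: "X i \<in> borel_measurable M" using X i by simp
    have "prob (X i -` (- A) \<inter> space M) = prob (space M - {\<omega> \<in> space M. X i \<omega> \<in> A})"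
      by (intro arg_cong[where f = prob]) auto
    also have "\<dots> = 1 - \<P>(\<omega> in M. X i \<omega> \<in> A)"
      by (rule prob_compl) measurable
    also have "\<dots> \<le> 1 + (- p)" using p[of i] i by simp
    also have "\<dots> \<le> exp (- p)" by (rule exp_ge_add_one_self)
    finally show "prob (X i -` (- A) \<inter> space M) \<le> exp (- p)" .
  qed
  also have "\<dots> = exp (- (real n * p))" by (simp flip: exp_of_nat_mult)
  finally show ?thesis .
qed

lemma (in prob_space) prob_no_empty_ball_ge:
  assumes ind: "indep_vars (\<lambda>_. borel) X {1..}" and n: "1 \<le> n"
    and C: "finite C" "C \<subseteq> sets borel"
    and p: "\<And>A i. A \<in> C \<Longrightarrow> 1 \<le> i \<Longrightarrow> p \<le> \<P>(\<omega> in M. X i \<omega> \<in> A)"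
  shows "1 - real (card C) * exp (- (real n * p)) \<le> \<P>(\<omega> in M. \<not> (\<exists>A\<in>C. empty_ball X n \<omega> A))"
proof -
  have X: "X i \<in> borel_measurable M" if "1 \<le> i" for i
    using ind that unfolding indep_vars_def by auto
  have ev: "{\<omega> \<in> space M. empty_ball X n \<omega> A} \<in> events" if "A \<in> C" for A
  proof -
    have [measurable]: "A \<in> sets borel" using C that by auto
    have "{\<omega> \<in> space M. X i \<omega> \<notin> A} \<in> events" if "i \<in> {1..n}" for i
    proof -
      have [measurable]: "X i \<in> borel_measurable M" using X that by simp
      show ?thesis by measurable
    qed
    then show ?thesis unfolding empty_ball_def
      by (intro sets.sets_Collect_finite_All') (use n in auto)
  qed
  have "\<P>(\<omega> in M. \<exists>A\<in>C. empty_ball X n \<omega> A) = prob (\<Union>A\<in>C. {\<omega> \<in> space M. empty_ball X n \<omega> A})"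
    by (intro arg_cong[where f = prob]) auto
  also have "\<dots> \<le> (\<Sum>A\<in>C. \<P>(\<omega> in M. empty_ball X n \<omega> A))"
    using C ev by (intro finite_measure_subadditive_finite) auto
  also have "\<dots> \<le> (\<Sum>A\<in>C. exp (- (real n * p)))"
    using C p by (intro sum_mono prob_empty_ball_le_exp[OF ind _ n]) auto
  finally have "\<P>(\<omega> in M. \<exists>A\<in>C. empty_ball X n \<omega> A) \<le> real (card C) * exp (- (real n * p))"
    by simp
  moreover have "\<P>(\<omega> in M. \<not> (\<exists>A\<in>C. empty_ball X n \<omega> A)) = 1 - \<P>(\<omega> in M. \<exists>A\<in>C. empty_ball X n \<omega> A)"
    by (intro prob_neg sets.sets_Collect_finite_Ex ev C)
  ultimately show ?thesis by simp
qed

lemma (in prob_space) prob_all_balls_empty_ge: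
  assumes X: "\<And>i. 1 \<le> i \<Longrightarrow> X i \<in> borel_measurable M"
    and C: "finite C" "C \<subseteq> sets borel"
    and p: "\<And>A i. A \<in> C \<Longrightarrow> 1 \<le> i \<Longrightarrow> \<P>(\<omega> in M. X i \<omega> \<in> A) \<le> p"
  shows "1 - real (card C) * real n * p \<le> \<P>(\<omega> in M. \<forall>A\<in>C. empty_ball X n \<omega> A)"
proof -
  define E where "E = (\<lambda>(A, i). {\<omega> \<in> space M. X i \<omega> \<in> A})"
  define I where "I = C \<times> {1..n}"
  have I: "finite I" "card I = card C * n" using C by (auto simp: I_def)
  have ev: "E j \<in> events" if "j \<in> I" for j
  proof -
    obtain A i where j: "j = (A, i)" "A \<in> C" "1 \<le> i" using \<open>j \<in> I\<close> by (auto simp: I_def)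
    have [measurable]: "A \<in> sets borel" "X i \<in> borel_measurable M" using C X j by auto
    show ?thesis unfolding E_def j by simp
  qed
  have "prob (\<Union>j\<in>I. E j) \<le> (\<Sum>j\<in>I. prob (E j))"
    using I ev by (intro finite_measure_subadditive_finite) auto
  also have "\<dots> \<le> (\<Sum>j\<in>I. p)"
    using p by (intro sum_mono) (auto simp: I_def E_def)
  finally have "prob (\<Union>j\<in>I. E j) \<le> real (card C) * real n * p"
    using I by simp
  moreover have "\<P>(\<omega> in M. \<forall>A\<in>C. empty_ball X n \<omega> A) = prob (space M - (\<Union>j\<in>I. E j))"
    by (intro arg_cong[where f = prob]) (auto simp: I_def E_def empty_ball_def)
  moreover have "prob (space M - (\<Union>j\<in>I. E j)) = 1 - prob (\<Union>j\<in>I. E j)"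
    using ev I by (intro prob_compl sets.finite_UN) auto
  ultimately show ?thesis by simp
qed

section \<open>Volume of a ball inside a cube\<close>

text \<open>
  A ball centered in a cube may leave the cube, but moving from the center towards the middle of
  the cube in every coordinate stays inside. The side \<open>s\<close> is at most \<open>B\<close> so that such a move
  cannot overshoot the opposite face, and small enough for the \<open>l\<^sub>1\<close> norm to keep the small cube
  inside the ball.
\<close>
lemma cube_in_ball_inter_cube:
  fixes x :: "real^'d"
  assumes x: "x \<in> cbox (\<chi> i. - B) (\<chi> i. B)" and B: "0 < B" and r: "0 < r"
  defines "s \<equiv> min B (r / (2 * real CARD('d)))"
  obtains a b :: "real^'d"
  where "cbox a b \<subseteq> ball x r \<inter> cbox (\<chi> i. - B) (\<chi> i. B)"
    and "measure lborel (cbox a b) = s ^ CARD('d)"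
proof -
  define a :: "real^'d" where "a = (\<chi> i. if x $ i \<le> 0 then x $ i else x $ i - s)"
  define b :: "real^'d" where "b = (\<chi> i. a $ i + s)"
  have s: "0 < s" "s \<le> B" "s \<le> r / (2 * real CARD('d))" using B r by (auto simp: s_def)
  have sub: "cbox a b \<subseteq> ball x r \<inter> cbox (\<chi> i. - B) (\<chi> i. B)"
  proof
    fix y assume "y \<in> cbox a b"
    then have y: "a $ i \<le> y $ i" "y $ i \<le> a $ i + s" for i
      by (auto simp: mem_box_cart b_def)
    have xB: "- B \<le> x $ i" "x $ i \<le> B" for i using x by (auto simp: mem_box_cart)
    have a: "a $ i = (if x $ i \<le> 0 then x $ i else x $ i - s)" for i by (simp add: a_def)
    have "\<bar>(x - y) $ i\<bar> \<le> s" for i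
      using y[of i] a[of i] s by (auto split: if_splits)
    then have "norm (x - y) \<le> (\<Sum>i\<in>(UNIV :: 'd set). s)"
      by (intro order.trans[OF norm_le_l1_cart] sum_mono)
    also have "\<dots> = real CARD('d) * s" by simp
    also have "\<dots> \<le> real CARD('d) * (r / (2 * real CARD('d)))"
      using s by (intro mult_left_mono) auto
    also have "\<dots> < r" using r by simp
    finally have "y \<in> ball x r" by (simp add: dist_norm)
    moreover have "y \<in> cbox (\<chi> i. - B) (\<chi> i. B)"
      unfolding mem_box_cart
    proof
      fix i show "(\<chi> i. - B) $ i \<le> y $ i \<and> y $ i \<le> (\<chi> i. B) $ i"
        using y[of i] a[of i] s xB[of i] by (auto split: if_splits)
    qed
    ultimately show "y \<in> ball x r \<inter> cbox (\<chi> i. - B) (\<chi> i. B)" by simp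
  qed
  have "cbox a b \<noteq> {}" using s by (auto simp: interval_ne_empty_cart b_def)
  then have "measure lborel (cbox a b) = s ^ CARD('d)"
    by (subst content_cbox_cart) (auto simp: b_def)
  with sub that show ?thesis by blast
qed

section \<open>Orders of smoothness near the zero-density region\<close>

lemma nbhd_mono: "e \<le> e' \<Longrightarrow> nbhd e S \<subseteq> nbhd e' S"
  by (auto simp: nbhd_def)

text \<open>
  A smaller neighbourhood admits more exponents, both in the infimum and in the supremum. The orders
  at scale \<open>\<epsilon>\<close> are therefore monotone, which is what makes their limits at zero exist.
\<close>
lemma upper_order_at_mono:
  assumes "e \<le> e'"
  shows "upper_order_at f S e \<le> upper_order_at f S e'"
proof -
  have "(INF x \<in> nbhd e' S - S. ereal (f x / infdist x S powr \<alpha>))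
      \<le> (INF x \<in> nbhd e S - S. ereal (f x / infdist x S powr \<alpha>))" for \<alpha>
    using nbhd_mono[OF assms, of S] by (intro INF_superset_mono) auto
  then show ?thesis unfolding upper_order_at_def
    by (intro Inf_superset_mono image_mono) (auto intro: less_le_trans)
qed

lemma lower_order_at_antimono:
  assumes "e \<le> e'"
  shows "lower_order_at f S e' \<le> lower_order_at f S e"
proof -
  have "(SUP x \<in> nbhd e S - S. ereal (f x / infdist x S powr \<alpha>))
      \<le> (SUP x \<in> nbhd e' S - S. ereal (f x / infdist x S powr \<alpha>))" for \<alpha>
    using nbhd_mono[OF assms, of S] by (intro SUP_subset_mono) auto
  then show ?thesis unfolding lower_order_at_def
    by (intro Sup_subset_mono image_mono Collect_mono) (meson le_less_trans)
qed

lemma upper_order_tendsto: "(upper_order_at f S \<longlongrightarrow> upper_order f S) (at_right 0)"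
  and upper_order_le: "0 < e \<Longrightarrow> upper_order f S \<le> upper_order_at f S e"
proof -
  have lim: "(upper_order_at f S \<longlongrightarrow> (INF e\<in>{0<..}. upper_order_at f S e)) (at_right 0)"
    using Lim_right_bound[of UNIV 0 "upper_order_at f S" "- \<infinity>"]
    by (simp add: upper_order_at_mono)
  have eq: "upper_order f S = (INF e\<in>{0<..}. upper_order_at f S e)"
    unfolding upper_order_def by (rule tendsto_Lim[OF _ lim]) simp
  show "(upper_order_at f S \<longlongrightarrow> upper_order f S) (at_right 0)" using lim eq by simp
  show "0 < e \<Longrightarrow> upper_order f S \<le> upper_order_at f S e" unfolding eq by (auto intro: INF_lower)
qed

lemma lower_order_tendsto: "(lower_order_at f S \<longlongrightarrow> lower_order f S) (at_right 0)"
  and lower_order_ge: "0 < e \<Longrightarrow> lower_order_at f S e \<le> lower_order f S"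
proof -
  have lim': "((\<lambda>e. - lower_order_at f S e) \<longlongrightarrow> (INF e\<in>{0<..}. - lower_order_at f S e)) (at_right 0)"
    using Lim_right_bound[of UNIV 0 "\<lambda>e. - lower_order_at f S e" "- \<infinity>"]
    by (simp add: lower_order_at_antimono)
  have lim: "(lower_order_at f S \<longlongrightarrow> (SUP e\<in>{0<..}. lower_order_at f S e)) (at_right 0)"
    using tendsto_uminus_ereal[OF lim'] by (simp add: ereal_INF_uminus_eq)
  have eq: "lower_order f S = (SUP e\<in>{0<..}. lower_order_at f S e)"
    unfolding lower_order_def by (rule tendsto_Lim[OF _ lim]) simp
  show "(lower_order_at f S \<longlongrightarrow> lower_order f S) (at_right 0)" using lim eq by simp
  show "0 < e \<Longrightarrow> lower_order_at f S e \<le> lower_order f S" unfolding eq by (auto intro: SUP_upper)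
qed

lemma upper_order_nonneg: "0 \<le> upper_order f S"
  by (rule tendsto_lowerbound[OF upper_order_tendsto])
    (auto simp: upper_order_at_def intro!: always_eventually INF_greatest)

text \<open>The convention \<open>ln 0 = 0\<close> makes the quotient nonnegative also when the covering number is zero,
  as it is for the empty set.\<close>
lemma has_minkowski_dim_nonneg:
  assumes "has_minkowski_dim E D"
  shows "0 \<le> D"
proof (rule tendsto_lowerbound)
  show "((\<lambda>\<Delta>. ln (real (covering_number \<Delta> E)) / (- ln \<Delta>)) \<longlongrightarrow> D) (at_right 0)"
    using assms by (simp add: has_minkowski_dim_def)
  have "\<forall>\<^sub>F \<Delta>::real in at_right 0. \<Delta> \<in> {0<..<1}"
    by (rule eventually_at_right_real) simp
  then show "\<forall>\<^sub>F \<Delta> in at_right 0. 0 \<le> ln (real (covering_number \<Delta> E)) / (- ln \<Delta>)"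
  proof eventually_elim
    case (elim \<Delta>)
    have "0 \<le> ln (real (covering_number \<Delta> E))"
      by (cases "covering_number \<Delta> E = 0") auto
    moreover have "0 \<le> - ln \<Delta>" using elim by simp
    ultimately show ?case by (rule divide_nonneg_nonneg)
  qed
qed simp

section \<open>Rates of sequences\<close>

lemma two_sided_O_lower:
  assumes "two_sided_O a (\<lambda>n. real n powr e)"
  obtains L where "0 < L" "\<forall>\<^sub>F n in sequentially. L * real n powr e \<le> a n"
  using assms unfolding two_sided_O_def eventually_at_top_dense by metis

lemma two_sided_O_upper:
  assumes "two_sided_O a (\<lambda>n. real n powr e)"
  obtains L where "0 < L" "\<forall>\<^sub>F n in sequentially. a n \<le> L * real n powr e"
  using assms unfolding two_sided_O_def eventually_at_top_dense by metis

lemma two_sided_O_tendsto_zero: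
  assumes a: "two_sided_O a (\<lambda>n. real n powr (- e))" and e: "0 < e"
  shows "filterlim a (at_right 0) sequentially"
proof -
  obtain L where L: "0 < L" "\<forall>\<^sub>F n in sequentially. a n \<le> L * real n powr (- e)"
    using a by (rule two_sided_O_upper)
  have pos: "\<forall>\<^sub>F n in sequentially. 0 < a n"
    using a unfolding two_sided_O_def eventually_sequentially by auto
  have "(\<lambda>n. L * real n powr (- e)) \<longlonglongrightarrow> 0" using e by real_asymp
  then have "a \<longlonglongrightarrow> 0"
    by (rule tendsto_sandwich[rotated 2, OF tendsto_const])
      (use L pos in \<open>auto elim: eventually_mono\<close>)
  with pos show ?thesis unfolding filterlim_at by (auto elim: eventually_mono)
qed

section \<open>Outside balls\<close>

text \<open>
  A point of an outside ball is at least \<open>e / 2\<close> away from \<open>S\<^sub>0\<close>. Replacing the order \<open>K\<close> at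
  scale \<open>e\<close> by a larger \<open>\<kappa>\<close> that does not depend on the scale only weakens the bound, since
  \<open>e / 2 < 1\<close>.
\<close>
lemma density_ge_near_outside_ball:
  assumes x: "x \<notin> nbhd e S\<^sub>0" and y: "y \<in> ball x r" and e: "2 * r \<le> e" "0 < e" "e < 1"
    and L: "0 < L" and \<kappa>: "K \<le> \<kappa>"
    and far: "y \<notin> nbhd e S\<^sub>0 \<Longrightarrow> m \<le> f y"
    and near: "y \<in> nbhd e S\<^sub>0 \<Longrightarrow> L * infdist y S\<^sub>0 powr K \<le> f y"
    and K: "0 \<le> K"
  shows "min m (L * (e / 2) powr \<kappa>) \<le> f y"
proof (cases "y \<in> nbhd e S\<^sub>0")
  case True
  have "e \<le> infdist x S\<^sub>0" using x by (simp add: nbhd_def)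
  also have "\<dots> \<le> infdist y S\<^sub>0 + dist x y" by (rule infdist_triangle)
  finally have "e / 2 \<le> infdist y S\<^sub>0" using y e by simp
  then have "(e / 2) powr K \<le> infdist y S\<^sub>0 powr K"
    using e K by (intro powr_mono2) auto
  moreover have "(e / 2) powr \<kappa> \<le> (e / 2) powr K"
    using e \<kappa> by (intro powr_mono') auto
  ultimately have "L * (e / 2) powr \<kappa> \<le> L * infdist y S\<^sub>0 powr K" using L by simp
  with near[OF True] show ?thesis by simp
qed (use far in simp)

text \<open>
  The exponent \<open>\<kappa>\<close> is strictly above the limiting upper order because the order at each fixed scale
  may exceed its limit. The two conditions in \<open>exps\<close> say that the expected number of points in an
  outside ball grows at least like a positive power of \<open>n\<close>, whichever of the two density bounds is smaller.
\<close>
lemma (in prob_space) prob_no_empty_outside_ball_tendsto: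
  fixes X :: "nat \<Rightarrow> 'a \<Rightarrow> real^'d" and f :: "real^'d \<Rightarrow> real"
    and S\<^sub>0 S :: "(real^'d) set" and \<B> :: "nat \<Rightarrow> (real^'d) set set"
    and r \<epsilon> m :: "nat \<Rightarrow> real" and \<epsilon>\<^sub>0 L B \<eta> \<psi> \<xi> \<kappa> :: real
  assumes ind: "indep_vars (\<lambda>_. borel) X {1..}"
    and dist: "\<And>i. 1 \<le> i \<Longrightarrow> distributed M lborel (X i) (\<lambda>x. ennreal (f x))"
    and S: "S = cbox (\<chi> i. - B) (\<chi> i. B)" "0 < B"
    and L: "0 < L" and \<epsilon>\<^sub>0: "0 < \<epsilon>\<^sub>0"
    and near: "\<And>e y. 0 < e \<Longrightarrow> e < min 1 \<epsilon>\<^sub>0 \<Longrightarrow> y \<in> nbhd e S\<^sub>0 \<inter> S \<Longrightarrow>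
      L * infdist y S\<^sub>0 powr real_of_ereal (upper_order_at f S\<^sub>0 e) \<le> f y"
    and far: "\<And>n y. 1 \<le> n \<Longrightarrow> y \<in> S - nbhd (\<epsilon> n) S\<^sub>0 \<Longrightarrow> m n \<le> f y"
    and centers: "\<And>n b. 1 \<le> n \<Longrightarrow> b \<in> \<B> n \<Longrightarrow> \<exists>x\<in>S. b = ball x (r n)"
    and r: "two_sided_O r (\<lambda>n. real n powr (- \<eta>))" and \<eta>: "0 < \<eta>"
    and card: "two_sided_O (\<lambda>n. real (card (\<B> n))) (\<lambda>n. real n powr (real CARD('d) * \<eta>))"
    and \<epsilon>: "two_sided_O \<epsilon> (\<lambda>n. real n powr (- \<psi>))" and \<psi>: "0 < \<psi>"
    and r\<epsilon>: "\<And>n. 1 \<le> n \<Longrightarrow> 2 * r n \<le> \<epsilon> n"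
    and m: "two_sided_O m (\<lambda>n. real n powr (- \<xi>))"
    and \<kappa>: "upper_order f S\<^sub>0 < ereal \<kappa>"
    and exps: "\<eta> * real CARD('d) + \<xi> < 1" "\<eta> * real CARD('d) + \<psi> * \<kappa> < 1"
  shows "(\<lambda>n. \<P>(\<omega> in M. \<not> (\<exists>b\<in>\<B> n. outside_ball (r n) (\<epsilon> n) S\<^sub>0 b \<and> empty_ball X n \<omega> b)))
           \<longlonglongrightarrow> 1"
proof -
  define D where "D = CARD('d)"
  define C where "C n = {b \<in> \<B> n. outside_ball (r n) (\<epsilon> n) S\<^sub>0 b}" for n
  obtain R where R: "0 < R" "\<forall>\<^sub>F n in sequentially. R * real n powr (- \<eta>) \<le> r n"
    using r by (rule two_sided_O_lower)
  obtain N where N: "0 < N" "\<forall>\<^sub>F n in sequentially. real (card (\<B> n)) \<le> N * real n powr (real D * \<eta>)"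
    using card unfolding D_def by (rule two_sided_O_upper)
  obtain E where E: "0 < E" "\<forall>\<^sub>F n in sequentially. E * real n powr (- \<psi>) \<le> \<epsilon> n"
    using \<epsilon> by (rule two_sided_O_lower)
  obtain m\<^sub>1 where m\<^sub>1: "0 < m\<^sub>1" "\<forall>\<^sub>F n in sequentially. m\<^sub>1 * real n powr (- \<xi>) \<le> m n"
    using m by (rule two_sided_O_lower)
  have \<kappa>0: "0 < \<kappa>" using upper_order_nonneg[of f S\<^sub>0] \<kappa> by (metis ereal_less(2) le_less_trans)
  \<comment> \<open>\<open>c n powr -\<beta>\<close> bounds the density from below, \<open>a n powr -\<eta>\<close> the side of the cube in the ball,
      and \<open>p n\<close> the mass of the ball.\<close>
  define \<beta> where "\<beta> = max \<xi> (\<psi> * \<kappa>)"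
  define c where "c = min m\<^sub>1 (L * (E / 2) powr \<kappa>)"
  define a where "a = min B (R / (2 * real D))"
  define p where "p n = (a * real n powr (- \<eta>)) ^ D * (c * real n powr (- \<beta>))" for n :: nat
  have D: "0 < D" by (simp add: D_def)
  have c: "0 < c" using m\<^sub>1 L E by (simp add: c_def)
  have a: "0 < a" "a \<le> B" "a \<le> R / (2 * real D)" using S R D by (auto simp: a_def)
  have \<epsilon>lim: "filterlim \<epsilon> (at_right 0) sequentially"
    using \<epsilon> \<psi> by (rule two_sided_O_tendsto_zero)
  have \<epsilon>small: "\<forall>\<^sub>F n in sequentially. \<epsilon> n \<in> {0<..<min 1 \<epsilon>\<^sub>0}"
    by (rule eventually_compose_filterlim[OF eventually_at_right_real \<epsilon>lim]) (use \<epsilon>\<^sub>0 in simp)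
  have order: "\<forall>\<^sub>F n in sequentially. upper_order_at f S\<^sub>0 (\<epsilon> n) < ereal \<kappa>"
    by (rule eventually_compose_filterlim[OF order_tendstoD(2)[OF upper_order_tendsto \<kappa>] \<epsilon>lim])
  have "\<forall>\<^sub>F n in sequentially. \<forall>A\<in>C n. \<forall>i\<ge>1. p n \<le> \<P>(\<omega> in M. X i \<omega> \<in> A)"
    using R(2) E(2) m\<^sub>1(2) \<epsilon>small order eventually_ge_at_top[of 1]
  proof eventually_elim
    case (elim n)
    let ?s = "min B (r n / (2 * real CARD('d)))"
    let ?q = "min (m n) (L * (\<epsilon> n / 2) powr \<kappa>)"
    have n: "0 < real n" "1 \<le> real n" using elim by auto
    have rn: "0 < r n" using r elim unfolding two_sided_O_def by simp
    have mn: "0 < m n" using m elim unfolding two_sided_O_def by simp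
    have s: "a * real n powr (- \<eta>) \<le> ?s"
    proof (rule min.boundedI)
      have "real n powr (- \<eta>) \<le> 1" using n \<eta> by (simp add: powr_le_one_le powr_minus_divide ge_one_powr_ge_zero)
      then have "a * real n powr (- \<eta>) \<le> a * 1" using a by (intro mult_left_mono) auto
      then show "a * real n powr (- \<eta>) \<le> B" using a by linarith
      have "a * real n powr (- \<eta>) \<le> R / (2 * real D) * real n powr (- \<eta>)"
        using a by (intro mult_right_mono) auto
      also have "\<dots> = R * real n powr (- \<eta>) / (2 * real D)" by simp
      also have "\<dots> \<le> r n / (2 * real D)" using elim by (intro divide_right_mono) auto
      finally show "a * real n powr (- \<eta>) \<le> r n / (2 * real CARD('d))" by (simp add: D_def)
    qed
    have q: "c * real n powr (- \<beta>) \<le> ?q"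
    proof (rule min.boundedI)
      have "c * real n powr (- \<beta>) \<le> m\<^sub>1 * real n powr (- \<xi>)"
        using n m\<^sub>1 by (intro mult_mono powr_mono) (auto simp: c_def \<beta>_def)
      then show "c * real n powr (- \<beta>) \<le> m n" using elim by simp
      have "(E / 2) powr \<kappa> * real n powr (- (\<psi> * \<kappa>)) = (E * real n powr (- \<psi>) / 2) powr \<kappa>"
        using E n by (simp add: powr_mult powr_divide powr_powr)
      also have "\<dots> \<le> (\<epsilon> n / 2) powr \<kappa>"
        using elim E \<kappa>0 by (intro powr_mono2) auto
      finally have *: "L * ((E / 2) powr \<kappa> * real n powr (- (\<psi> * \<kappa>))) \<le> L * (\<epsilon> n / 2) powr \<kappa>"
        using L by simp
      have "c * real n powr (- \<beta>) \<le> L * (E / 2) powr \<kappa> * real n powr (- (\<psi> * \<kappa>))"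
        using n L by (intro mult_mono powr_mono) (auto simp: c_def \<beta>_def)
      with * show "c * real n powr (- \<beta>) \<le> L * (\<epsilon> n / 2) powr \<kappa>" by (simp add: mult.assoc)
    qed
    show ?case
    proof (intro ballI allI impI)
      fix A i assume A: "A \<in> C n" and i: "1 \<le> (i::nat)"
      obtain x where x: "x \<in> S" "A = ball x (r n)" "x \<notin> nbhd (\<epsilon> n) S\<^sub>0"
        using A centers[of n A] elim rn by (auto simp: C_def outside_ball_def ball_eq_ball_iff)
      obtain u v where Q: "cbox u v \<subseteq> ball x (r n) \<inter> S" "measure lborel (cbox u v) = ?s ^ CARD('d)"
        using cube_in_ball_inter_cube[of x B "r n"] x S rn by metis
      have Kn: "0 \<le> upper_order_at f S\<^sub>0 (\<epsilon> n)"
        using upper_order_nonneg[of f S\<^sub>0] upper_order_le[of "\<epsilon> n" f S\<^sub>0] elim by force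
      have K: "0 \<le> real_of_ereal (upper_order_at f S\<^sub>0 (\<epsilon> n))"
        "real_of_ereal (upper_order_at f S\<^sub>0 (\<epsilon> n)) \<le> \<kappa>"
        using Kn elim by (cases "upper_order_at f S\<^sub>0 (\<epsilon> n)"; simp)+
      have "?q \<le> f y" if "y \<in> cbox u v" for y
        using Q that elim r\<epsilon>[of n]
        by (intro density_ge_near_outside_ball[OF x(3) _ _ _ _ L K(2) _ _ K(1), of y "r n"] far near) auto
      then have "?q * measure lborel (cbox u v) \<le> \<P>(\<omega> in M. X i \<omega> \<in> cbox u v)"
        using mn L emeasure_lborel_cbox_finite[of u v] by (intro prob_density_ge[OF dist[OF i]]) auto
      also have "\<dots> \<le> \<P>(\<omega> in M. X i \<omega> \<in> A)"
      proof -
        have [measurable]: "X i \<in> borel_measurable M"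
          using distributed_measurable[OF dist[OF i]] by simp
        show ?thesis using Q x by (intro finite_measure_mono) auto
      qed
      finally have "?q * ?s ^ D \<le> \<P>(\<omega> in M. X i \<omega> \<in> A)" unfolding Q D_def .
      moreover have "p n \<le> ?s ^ D * ?q"
        unfolding p_def using s q a c n S rn
        by (intro mult_mono power_mono) (auto intro!: zero_le_power)
      ultimately show "p n \<le> \<P>(\<omega> in M. X i \<omega> \<in> A)" by (simp add: mult.commute)
    qed
  qed
  then have bound: "\<forall>\<^sub>F n in sequentially.
      1 - N * real n powr (real D * \<eta>) * exp (- (a ^ D * c * real n powr (1 - (\<eta> * real D + \<beta>))))
        \<le> \<P>(\<omega> in M. \<not> (\<exists>b\<in>\<B> n. outside_ball (r n) (\<epsilon> n) S\<^sub>0 b \<and> empty_ball X n \<omega> b))"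
    using N(2) eventually_ge_at_top[of 1]
  proof eventually_elim
    case (elim n)
    have n: "0 < real n" using elim by simp
    have "0 < real (card (\<B> n))" using card elim unfolding two_sided_O_def by blast
    then have fin: "finite (\<B> n)" by (metis card.infinite less_irrefl of_nat_0)
    have "card (C n) \<le> card (\<B> n)" using fin by (auto simp: C_def intro: card_mono)
    then have cN: "real (card (C n)) \<le> N * real n powr (real D * \<eta>)" using elim by linarith
    have np: "real n * p n = a ^ D * c * real n powr (1 - (\<eta> * real D + \<beta>))"
    proof -
      have "real n * p n = a ^ D * c * (real n powr 1 * real n powr (- (\<eta> * real D)) * real n powr (- \<beta>))"
        using n by (simp add: p_def power_mult_distrib powr_power mult.commute[of \<eta>])
      also have "\<dots> = a ^ D * c * real n powr (1 - (\<eta> * real D + \<beta>))"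
        by (simp only: powr_add[symmetric]) (simp add: algebra_simps)
      finally show ?thesis .
    qed
    have "1 - N * real n powr (real D * \<eta>) * exp (- (real n * p n))
        \<le> 1 - real (card (C n)) * exp (- (real n * p n))"
      using cN by (simp add: mult_right_mono)
    also have "\<dots> \<le> \<P>(\<omega> in M. \<not> (\<exists>A\<in>C n. empty_ball X n \<omega> A))"
      using elim fin
      by (intro prob_no_empty_ball_ge[OF ind]) (auto simp: C_def outside_ball_def)
    also have "\<dots> = \<P>(\<omega> in M. \<not> (\<exists>b\<in>\<B> n. outside_ball (r n) (\<epsilon> n) S\<^sub>0 b \<and> empty_ball X n \<omega> b))"
      by (intro arg_cong[where f = prob]) (auto simp: C_def)
    finally show ?case unfolding np .
  qed
  show ?thesis
  proof (rule tendsto_sandwich[OF bound _ _ tendsto_const])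
    define t where "t = 1 - (\<eta> * real D + \<beta>)"
    define A where "A = a ^ D * c"
    have "0 < t" "0 < A" using exps a c by (auto simp: t_def D_def A_def \<beta>_def)
    moreover have "0 < real D * \<eta>" using D \<eta> by simp
    ultimately have "(\<lambda>n. 1 - N * real n powr (real D * \<eta>) * exp (- (A * real n powr t))) \<longlonglongrightarrow> 1"
      by real_asymp
    then show "(\<lambda>n. 1 - N * real n powr (real D * \<eta>) *
        exp (- (a ^ D * c * real n powr (1 - (\<eta> * real D + \<beta>))))) \<longlonglongrightarrow> 1"
      by (simp add: t_def A_def)
  qed simp
qed

section \<open>Inside balls\<close>

text \<open>
  Condition \<open>exps\<close> says that the expected number of pairs of a sample point and an inside ball
  containing it tends to zero: there are \<open>n powr h\<close> balls and \<open>n\<close> points, and a ball has mass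
  \<open>n powr -(\<kappa>\<eta> + d\<eta>)\<close>, up to constants. Compactness of \<open>S\<^sub>0\<close> gives a uniform distance from \<open>S\<^sub>0\<close>
  to the complement of \<open>S\<close>, so that the density bound on \<open>S\<close> covers whole balls.
\<close>
lemma (in prob_space) prob_all_inside_balls_empty_tendsto:
  fixes X :: "nat \<Rightarrow> 'a \<Rightarrow> real^'d" and f :: "real^'d \<Rightarrow> real"
    and S\<^sub>0 S :: "(real^'d) set" and \<B> :: "nat \<Rightarrow> (real^'d) set set"
    and r \<epsilon> H :: "nat \<Rightarrow> real" and \<epsilon>\<^sub>0 U \<eta> \<psi> \<kappa> h :: real
  assumes dist: "\<And>i. 1 \<le> i \<Longrightarrow> distributed M lborel (X i) (\<lambda>x. ennreal (f x))"
    and S\<^sub>0: "compact S\<^sub>0" "S\<^sub>0 \<subseteq> interior S"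
    and U: "0 < U" and \<epsilon>\<^sub>0: "0 < \<epsilon>\<^sub>0"
    and near: "\<And>e y. 0 < e \<Longrightarrow> e < min 1 \<epsilon>\<^sub>0 \<Longrightarrow> y \<in> nbhd e S\<^sub>0 \<inter> S \<Longrightarrow>
      f y \<le> U * infdist y S\<^sub>0 powr real_of_ereal (lower_order_at f S\<^sub>0 e)"
    and fin: "\<And>n. 1 \<le> n \<Longrightarrow> finite (\<B> n)"
    and r: "two_sided_O r (\<lambda>n. real n powr (- \<eta>))"
    and \<epsilon>: "two_sided_O \<epsilon> (\<lambda>n. real n powr (- \<psi>))" and \<psi>: "0 < \<psi>"
    and r\<epsilon>: "\<And>n. 1 \<le> n \<Longrightarrow> 2 * r n \<le> \<epsilon> n"
    and H: "two_sided_O H (\<lambda>n. real n powr h)"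
    and card: "\<And>n. 1 \<le> n \<Longrightarrow> real (card {b \<in> \<B> n. b \<inter> S\<^sub>0 \<noteq> {}}) \<le> H n"
    and \<kappa>: "0 < \<kappa>" "ereal \<kappa> < lower_order f S\<^sub>0" "lower_order f S\<^sub>0 < \<infinity>"
    and exps: "1 + h < \<kappa> * \<eta> + real CARD('d) * \<eta>"
  shows "(\<lambda>n. \<P>(\<omega> in M. \<forall>b\<in>\<B> n. inside_ball (r n) (\<epsilon> n) S\<^sub>0 b \<longrightarrow> empty_ball X n \<omega> b))
           \<longlonglongrightarrow> 1"
proof -
  define D where "D = CARD('d)"
  define C where "C n = {b \<in> \<B> n. inside_ball (r n) (\<epsilon> n) S\<^sub>0 b}" for n
  define V where "V = unit_ball_vol (real D)"
  obtain R where R: "0 < R" "\<forall>\<^sub>F n in sequentially. r n \<le> R * real n powr (- \<eta>)"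
    using r by (rule two_sided_O_upper)
  obtain N where N: "0 < N" "\<forall>\<^sub>F n in sequentially. H n \<le> N * real n powr h"
    using H by (rule two_sided_O_upper)
  obtain \<rho> where \<rho>: "0 < \<rho>" "(\<Union>z\<in>S\<^sub>0. ball z \<rho>) \<subseteq> interior S"
    using compact_subset_open_imp_ball_epsilon_subset[OF S\<^sub>0(1) open_interior S\<^sub>0(2)] by blast
  define p where "p n = U * (2 * (R * real n powr (- \<eta>))) powr \<kappa> * (V * (R * real n powr (- \<eta>)) ^ D)"
    for n :: nat
  have V: "0 \<le> V" by (simp add: V_def)
  have \<epsilon>lim: "filterlim \<epsilon> (at_right 0) sequentially"
    using \<epsilon> \<psi> by (rule two_sided_O_tendsto_zero)
  have \<epsilon>small: "\<forall>\<^sub>F n in sequentially. \<epsilon> n \<in> {0<..<min \<rho> (min 1 \<epsilon>\<^sub>0)}"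
    by (rule eventually_compose_filterlim[OF eventually_at_right_real \<epsilon>lim]) (use \<epsilon>\<^sub>0 \<rho> in simp)
  have order: "\<forall>\<^sub>F n in sequentially. ereal \<kappa> < lower_order_at f S\<^sub>0 (\<epsilon> n)"
    by (rule eventually_compose_filterlim[OF order_tendstoD(1)[OF lower_order_tendsto \<kappa>(2)] \<epsilon>lim])
  have "\<forall>\<^sub>F n in sequentially. \<forall>A\<in>C n. \<forall>i\<ge>1. \<P>(\<omega> in M. X i \<omega> \<in> A) \<le> p n"
    using R(2) \<epsilon>small order eventually_ge_at_top[of 1]
  proof eventually_elim
    case (elim n)
    have rn: "0 < r n" using r elim unfolding two_sided_O_def by simp
    define K where "K = real_of_ereal (lower_order_at f S\<^sub>0 (\<epsilon> n))"
    have "lower_order_at f S\<^sub>0 (\<epsilon> n) < \<infinity>"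
      using lower_order_ge[of "\<epsilon> n" f S\<^sub>0] \<kappa>(3) elim by (auto intro: le_less_trans)
    then have K: "\<kappa> < K" using elim unfolding K_def
      by (cases "lower_order_at f S\<^sub>0 (\<epsilon> n)") auto
    show ?case
    proof (intro ballI allI impI)
      fix A i assume A: "A \<in> C n" and i: "1 \<le> (i::nat)"
      obtain x z where x: "A = ball x (r n)" and z: "z \<in> ball x (r n)" "z \<in> S\<^sub>0"
        using A unfolding C_def inside_ball_def by blast
      have f_le: "f y \<le> U * (2 * r n) powr \<kappa>" if y: "y \<in> A" for y
      proof -
        have "dist y z \<le> dist x y + dist x z" by (metis dist_commute dist_triangle)
        also have "\<dots> < 2 * r n" using y z x by simp
        finally have yz: "dist y z < 2 * r n" .
        have inf: "infdist y S\<^sub>0 < 2 * r n" using infdist_le[OF z(2), of y] yz by linarith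
        have "dist z y < \<rho>" using yz r\<epsilon>[of n] elim by (simp add: dist_commute)
        then have "y \<in> S" using \<rho>(2) z interior_subset[of S] by (meson UN_I mem_ball subsetD)
        moreover have "y \<in> nbhd (\<epsilon> n) S\<^sub>0" using inf r\<epsilon>[of n] elim by (simp add: nbhd_def)
        ultimately have "f y \<le> U * infdist y S\<^sub>0 powr K"
          unfolding K_def using elim by (intro near) auto
        also have "\<dots> \<le> U * (2 * r n) powr K"
          using U K \<kappa> inf by (intro mult_left_mono powr_mono2) (auto simp: infdist_nonneg)
        also have "\<dots> \<le> U * (2 * r n) powr \<kappa>"
          using U K rn r\<epsilon>[of n] elim by (intro mult_left_mono powr_mono') auto
        finally show ?thesis .
      qed
      have "\<P>(\<omega> in M. X i \<omega> \<in> A) \<le> U * (2 * r n) powr \<kappa> * measure lborel A"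
        using U f_le emeasure_lborel_ball_finite[of x "r n"]
        by (intro prob_density_le[OF dist[OF i]]) (auto simp: x)
      also have "measure lborel A = V * r n ^ D"
        using rn by (simp add: x content_ball V_def D_def)
      also have "U * (2 * r n) powr \<kappa> * (V * r n ^ D) \<le> p n"
        unfolding p_def using U V rn elim \<kappa>
        by (intro mult_mono mult_left_mono powr_mono2 power_mono) auto
      finally show "\<P>(\<omega> in M. X i \<omega> \<in> A) \<le> p n" .
    qed
  qed
  define c where "c = N * (U * (2 * R) powr \<kappa> * V * R ^ D)"
  define t where "t = 1 + h - (\<kappa> * \<eta> + real D * \<eta>)"
  have bound: "\<forall>\<^sub>F n in sequentially. 1 - c * real n powr t
        \<le> \<P>(\<omega> in M. \<forall>b\<in>\<B> n. inside_ball (r n) (\<epsilon> n) S\<^sub>0 b \<longrightarrow> empty_ball X n \<omega> b)"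
    using \<open>\<forall>\<^sub>F n in sequentially. \<forall>A\<in>C n. \<forall>i\<ge>1. \<P>(\<omega> in M. X i \<omega> \<in> A) \<le> p n\<close>
      N(2) eventually_ge_at_top[of 1]
  proof eventually_elim
    case (elim n)
    have n: "0 < real n" using elim by simp
    have "card (C n) \<le> card {b \<in> \<B> n. b \<inter> S\<^sub>0 \<noteq> {}}"
      using fin[of n] elim by (intro card_mono) (auto simp: C_def inside_ball_def)
    then have cN: "real (card (C n)) \<le> N * real n powr h" using elim card[of n] by linarith
    have "N * real n powr h * real n * p n =
        c * (real n powr 1 * real n powr h * real n powr (- (\<kappa> * \<eta>)) * real n powr (- (real D * \<eta>)))"
      using n R by (simp add: p_def c_def power_mult_distrib powr_power powr_mult powr_powr mult_ac)
    also have "\<dots> = c * real n powr t"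
      by (simp only: powr_add[symmetric]) (simp add: t_def algebra_simps)
    finally have np: "N * real n powr h * real n * p n = c * real n powr t" .
    have p0: "0 \<le> p n" using U V R by (simp add: p_def)
    have "1 - c * real n powr t \<le> 1 - real (card (C n)) * real n * p n"
      unfolding np[symmetric] using cN p0 n by (simp add: mult_right_mono)
    also have "\<dots> \<le> \<P>(\<omega> in M. \<forall>A\<in>C n. empty_ball X n \<omega> A)"
      using elim fin[of n] distributed_measurable[OF dist]
      by (intro prob_all_balls_empty_ge) (auto simp: C_def inside_ball_def)
    also have "\<dots> = \<P>(\<omega> in M. \<forall>b\<in>\<B> n. inside_ball (r n) (\<epsilon> n) S\<^sub>0 b \<longrightarrow> empty_ball X n \<omega> b)"
      by (intro arg_cong[where f = prob]) (auto simp: C_def)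
    finally show ?case .
  qed
  show ?thesis
  proof (rule tendsto_sandwich[OF bound _ _ tendsto_const])
    have "t < 0" using exps by (simp add: t_def D_def)
    then show "(\<lambda>n. 1 - c * real n powr t) \<longlonglongrightarrow> 1" by real_asymp
  qed simp
qed

section \<open>Asymptotic occupancy of outside and inside balls\<close>

theorem theorem4p2:
  fixes M :: "'w measure"
    and X :: "nat \<Rightarrow> 'w \<Rightarrow> real^'d"
    and f :: "real^'d \<Rightarrow> real"
    and M' S\<^sub>0 S\<^sub>f :: "(real^'d) set"
    and \<B> :: "nat \<Rightarrow> (real^'d) set set"
    and r \<epsilon> m :: "nat \<Rightarrow> real"
    and d\<^sub>0 \<delta> \<epsilon>\<^sub>0 L\<^sub>f U\<^sub>f \<eta> \<psi> \<xi> :: real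
  assumes "prob_space M"
    and "prob_space.indep_vars M (\<lambda>_. borel) X {1..}"
    and "\<forall>x. 0 \<le> f x"
    and "\<forall>i\<ge>1. distributed M lborel (X i) (\<lambda>x. ennreal (f x))"
    and "M' = rv_support M (X 1)" and "\<not> compact M'"
    and "\<forall>x. x \<notin> M' \<longrightarrow> f x = 0" and "continuous_on M' f"
    and "S\<^sub>0 = {x \<in> M'. f x = 0}"
    and "has_minkowski_dim S\<^sub>0 d\<^sub>0" and "d\<^sub>0 < real CARD('d)"
    and "S\<^sub>0 \<subseteq> interior M'" and "card (components S\<^sub>0) = 1"
    and "0 < \<delta>" and "\<delta> < 1"
    and "delta_support M (X 1) \<delta> S\<^sub>0 S\<^sub>f" and "S\<^sub>f \<subseteq> interior M'"
    and i: "0 < \<epsilon>\<^sub>0"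
      "0 < upper_order_at f S\<^sub>0 \<epsilon>\<^sub>0" "upper_order_at f S\<^sub>0 \<epsilon>\<^sub>0 < \<infinity>"
      "0 < lower_order_at f S\<^sub>0 \<epsilon>\<^sub>0" "lower_order_at f S\<^sub>0 \<epsilon>\<^sub>0 < \<infinity>"
    and ii: "0 < L\<^sub>f" "0 < U\<^sub>f"
      "\<forall>e. 0 < e \<and> e < min 1 \<epsilon>\<^sub>0 \<longrightarrow> (\<forall>x \<in> nbhd e S\<^sub>0 \<inter> S\<^sub>f.
         L\<^sub>f * infdist x S\<^sub>0 powr real_of_ereal (upper_order_at f S\<^sub>0 e) \<le> f x \<and>
         f x \<le> U\<^sub>f * infdist x S\<^sub>0 powr real_of_ereal (lower_order_at f S\<^sub>0 e))"
    and iii: "\<forall>n\<ge>1. ball_covering (r n) S\<^sub>f (\<B> n)"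
      "\<forall>n\<ge>1. \<forall>b\<in>\<B> n. \<exists>x \<in> interior S\<^sub>f. b = ball x (r n)"
      "two_sided_O r (\<lambda>n. real n powr (- \<eta>))"
      "0 < \<eta>" "\<eta> < 1 / real CARD('d)"
      "two_sided_O (\<lambda>n. real (card (\<B> n))) (\<lambda>n. real n powr (real CARD('d) * \<eta>))"
    and iv: "\<forall>\<tau>>0. \<exists>H. two_sided_O H (\<lambda>n. real n powr (d\<^sub>0 * \<eta> * (1 + \<tau>))) \<and>
         (\<forall>n\<ge>1. real (card {b \<in> \<B> n. b \<inter> S\<^sub>0 \<noteq> {}}) \<le> H n)"
    and v: "two_sided_O \<epsilon> (\<lambda>n. real n powr (- \<psi>))" "0 < \<psi>" "\<psi> \<le> \<eta>"
      "\<forall>n\<ge>1. 2 * r n \<le> \<epsilon> n \<and> \<epsilon> n < 1"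
    and vi: "\<forall>n\<ge>1. m n \<in> f ` (S\<^sub>f - nbhd (\<epsilon> n) S\<^sub>0) \<and>
         (\<forall>w \<in> S\<^sub>f - nbhd (\<epsilon> n) S\<^sub>0. m n \<le> f w) \<and> 0 < m n"
      "two_sided_O m (\<lambda>n. real n powr (- \<xi>))"
      "0 < \<xi>" "\<xi> < (1 - 2 * \<eta> * real CARD('d)) / 2"
  shows
    "(1 - 2 * \<eta> * real CARD('d) - 2 * real_of_ereal (upper_order f S\<^sub>0) * \<psi> > 0 \<longrightarrow>
       (\<lambda>n. \<P>(\<omega> in M. \<not> (\<exists>b\<in>\<B> n. outside_ball (r n) (\<epsilon> n) S\<^sub>0 b \<and> empty_ball X n \<omega> b)))
         \<longlonglongrightarrow> 1) \<and>
     (1 + d\<^sub>0 * \<eta> - real_of_ereal (lower_order f S\<^sub>0) * \<eta> - real CARD('d) * \<eta> < 0 \<longrightarrow>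
       (\<lambda>n. \<P>(\<omega> in M. \<forall>b\<in>\<B> n. inside_ball (r n) (\<epsilon> n) S\<^sub>0 b \<longrightarrow> empty_ball X n \<omega> b))
         \<longlonglongrightarrow> 1)"
proof (intro conjI impI)
  interpret prob_space M by fact
  have dist: "distributed M lborel (X i) (\<lambda>x. ennreal (f x))" if "1 \<le> i" for i
    using assms(4) that by simp
  obtain B where S: "S\<^sub>f = cbox (\<chi> i. - B) (\<chi> i. B)" "0 < B"
    using assms(16) unfolding delta_support_def by blast
  have S\<^sub>0_int: "S\<^sub>0 \<subseteq> interior S\<^sub>f" using assms(16) unfolding delta_support_def by blast
  have d\<eta>: "\<eta> * real CARD('d) < 1" using iii(5) by (simp add: field_simps)
  {
    assume A: "1 - 2 * \<eta> * real CARD('d) - 2 * real_of_ereal (upper_order f S\<^sub>0) * \<psi> > 0"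
    define K where "K = real_of_ereal (upper_order f S\<^sub>0)"
    have "upper_order f S\<^sub>0 < \<infinity>" using upper_order_le[OF i(1), of f S\<^sub>0] i(3) by (rule le_less_trans)
    then have K: "upper_order f S\<^sub>0 = ereal K"
      unfolding K_def using upper_order_nonneg[of f S\<^sub>0] by (cases "upper_order f S\<^sub>0") auto
    have "K * \<psi> < 1 - \<eta> * real CARD('d)" using A d\<eta> unfolding K_def by (simp add: algebra_simps)
    then have "K < (1 - \<eta> * real CARD('d)) / \<psi>" using v(2) by (simp add: pos_less_divide_eq)
    then obtain \<kappa> where \<kappa>: "K < \<kappa>" "\<kappa> < (1 - \<eta> * real CARD('d)) / \<psi>" using dense by blast
    show "(\<lambda>n. \<P>(\<omega> in M. \<not> (\<exists>b\<in>\<B> n. outside_ball (r n) (\<epsilon> n) S\<^sub>0 b \<and> empty_ball X n \<omega> b)))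
         \<longlonglongrightarrow> 1"
    proof (rule prob_no_empty_outside_ball_tendsto[OF assms(2) dist S ii(1) i(1) _ _ _ iii(3,4,6) v(1,2) _ vi(2)])
      show "upper_order f S\<^sub>0 < ereal \<kappa>" using \<kappa> K by simp
      show "\<eta> * real CARD('d) + \<psi> * \<kappa> < 1" using \<kappa> v(2) by (simp add: pos_less_divide_eq algebra_simps)
      have "\<eta> * real CARD('d) > 0" using iii(4) by simp
      then show "\<eta> * real CARD('d) + \<xi> < 1" using vi(4) by simp
      show "\<exists>x\<in>S\<^sub>f. b = ball x (r n)" if "1 \<le> n" "b \<in> \<B> n" for n b
        using iii(2) that interior_subset by blast
    qed (use ii(3) vi(1) v(4) in auto)
  }
  {
    assume B: "1 + d\<^sub>0 * \<eta> - real_of_ereal (lower_order f S\<^sub>0) * \<eta> - real CARD('d) * \<eta> < 0"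
    define K where "K = real_of_ereal (lower_order f S\<^sub>0)"
    have d0: "0 \<le> d\<^sub>0" using assms(10) by (rule has_minkowski_dim_nonneg)
    have pos: "0 < 1 + d\<^sub>0 * \<eta> - real CARD('d) * \<eta>"
      using d\<eta> mult_nonneg_nonneg[OF d0 less_imp_le[OF iii(4)]] mult.commute[of \<eta> "real CARD('d)"]
      by linarith
    \<comment> \<open>If the lower order were infinite, its real part would be the default value \<open>0\<close>, contrary
        to \<open>B\<close> and \<open>pos\<close>.\<close>
    have "K \<noteq> 0" using B pos unfolding K_def by auto
    then have K: "lower_order f S\<^sub>0 = ereal K"
      unfolding K_def by (cases "lower_order f S\<^sub>0") auto
    have "(1 + d\<^sub>0 * \<eta> - real CARD('d) * \<eta>) / \<eta> < K"
      using B iii(4) unfolding K_def by (simp add: pos_divide_less_eq algebra_simps)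
    then obtain \<kappa> where \<kappa>: "(1 + d\<^sub>0 * \<eta> - real CARD('d) * \<eta>) / \<eta> < \<kappa>" "\<kappa> < K"
      using dense by blast
    have \<kappa>0: "0 < \<kappa>" using pos iii(4) \<kappa>(1) by (meson divide_pos_pos less_trans)
    \<comment> \<open>\<open>s\<close> is the slack in the exponents left by \<open>\<kappa>\<close>; \<open>\<tau>\<close> has to fit into it.\<close>
    define s where "s = \<kappa> * \<eta> + real CARD('d) * \<eta> - (1 + d\<^sub>0 * \<eta>)"
    have s: "0 < s" using \<kappa>(1) iii(4) by (simp add: s_def pos_divide_less_eq)
    define \<tau> where "\<tau> = s / (d\<^sub>0 * \<eta> + 1)"
    have "0 < d\<^sub>0 * \<eta> + 1" using d0 iii(4) by (simp add: add_nonneg_pos)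
    then have \<tau>: "0 < \<tau>" "d\<^sub>0 * \<eta> * \<tau> < s" using s by (auto simp: \<tau>_def field_simps)
    obtain H where H: "two_sided_O H (\<lambda>n. real n powr (d\<^sub>0 * \<eta> * (1 + \<tau>)))"
      "\<forall>n\<ge>1. real (card {b \<in> \<B> n. b \<inter> S\<^sub>0 \<noteq> {}}) \<le> H n"
      using iv \<tau>(1) by blast
    have "closed M'" unfolding assms(5) rv_support_def by auto
    then have "closed S\<^sub>0"
      unfolding assms(9) using assms(8) by (intro continuous_closed_preimage_constant)
    then have "compact S\<^sub>0"
      using assms(10) by (simp add: has_minkowski_dim_def compact_eq_bounded_closed)
    have fin: "finite (\<B> n)" if "1 \<le> n" for n
    proof -
      have "0 < real (card (\<B> n))" using iii(6) that unfolding two_sided_O_def by blast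
      then show ?thesis by (metis card.infinite less_irrefl of_nat_0)
    qed
    show "(\<lambda>n. \<P>(\<omega> in M. \<forall>b\<in>\<B> n. inside_ball (r n) (\<epsilon> n) S\<^sub>0 b \<longrightarrow> empty_ball X n \<omega> b))
         \<longlonglongrightarrow> 1"
    proof (rule prob_all_inside_balls_empty_tendsto[OF dist \<open>compact S\<^sub>0\<close> S\<^sub>0_int ii(2) i(1) _ fin iii(3)
          v(1,2) _ H(1) _ \<kappa>0])
      show "ereal \<kappa> < lower_order f S\<^sub>0" "lower_order f S\<^sub>0 < \<infinity>" using K \<kappa> by auto
      show "1 + d\<^sub>0 * \<eta> * (1 + \<tau>) < \<kappa> * \<eta> + real CARD('d) * \<eta>"
        using \<tau>(2) by (simp add: s_def algebra_simps)
    qed (use ii(3) v(4) H(2) in auto)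
  }
qed

end
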